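(* Let $V$ be a normed space, let $p$ be an element of a closed, convex subset $C$ of $V$, and let $v\in V$. Then there is a continuous curve $c\colon[0,+\infty)\to C$ such that $c(0)=p$ and $\left.\frac{dc(t)}{dt}\right|_{t=0+}=v$ if, and only if, $\theta(v)\geq 0$ for all $\theta\in V^*$ for which $\theta(p)=\inf_{q\in C}\theta(q)$.
   Context: Vector spaces are real; $V^*$ denotes the topological dual of $V$. The one-sided derivative is $\left.\frac{dc(t)}{dt}\right|_{t=0+}=\lim_{t\to0+}\frac{c(t)-c(0)}{t}$, the limit being taken in $V$. *)

theory Defs
  imports "HOL-Analysis.Analysis"
begin

end

theory Submission imports Defs begin

text \<open>
  Call \<open>K\<close> the cone generated by \<open>C - p\<close>. Both sides of the equivalence say that \<open>v\<close> lies in the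
  closure of \<open>K\<close>: the functionals attaining their infimum over \<open>C\<close> at \<open>p\<close> are exactly those that are
  nonnegative on \<open>K\<close>, and the closure of \<open>K\<close> is the set of admissible velocities at \<open>p\<close>.

  That a velocity satisfies the dual condition is immediate
  (\<open>velocity_nonneg_on_support\<close>): such a functional is nonnegative on every difference quotient of
  the curve.

  For the converse, suppose that \<open>v\<close> is not in the closure of \<open>K\<close>. The distance to a convex cone is a
  sublinear functional that vanishes on the cone, so the Hahn-Banach theorem yields a linear \<open>f\<close>
  below the distance to \<open>K\<close> with \<open>f v\<close> equal to the distance of \<open>v\<close>, which is positive
  (\<open>separate_point_convex_cone\<close>). Then \<open>-f\<close> violates the dual condition. The Hahn-Banach theorem
  itself comes from the fact that minimal sublinear functionals are linear; minimal ones exist by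
  Zorn's lemma.

  When \<open>v\<close> is in the closure of \<open>K\<close>, convexity of \<open>C\<close> makes the distance of \<open>p + t v\<close> to \<open>C\<close> negligible
  compared with \<open>t\<close> (\<open>infdist_ray_le\<close>). A nearest point of \<open>C\<close> need not exist, nor depend
  continuously on \<open>t\<close>. But the points of \<open>C\<close> whose distance to \<open>p + t v\<close> is less than the
  infimum plus \<open>t\<^sup>2\<close> form a nonempty convex set, and a partition of unity makes a continuous choice
  among them (\<open>continuous_almost_nearest_point\<close>). The error \<open>t\<^sup>2\<close> does not affect the velocity
  at \<open>0\<close>.
\<close>

section \<open>Sublinear functionals and the Hahn-Banach theorem\<close>

definition sublinear :: "('a::real_vector \<Rightarrow> real) \<Rightarrow> bool" where
  "sublinear q \<longleftrightarrow>
     (\<forall>x y. q (x + y) \<le> q x + q y) \<and> (\<forall>a x. 0 \<le> a \<longrightarrow> q (a *\<^sub>R x) = a * q x)"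

lemma sublinear_add: "sublinear q \<Longrightarrow> q (x + y) \<le> q x + q y"
  by (simp add: sublinear_def)

lemma sublinear_scaleR: "sublinear q \<Longrightarrow> 0 \<le> a \<Longrightarrow> q (a *\<^sub>R x) = a * q x"
  by (simp add: sublinear_def)

lemma sublinear_zero: "sublinear q \<Longrightarrow> q 0 = 0"
  using sublinear_scaleR[of q 0 0] by simp

lemma sublinear_minus: "sublinear q \<Longrightarrow> - q (- x) \<le> q x"
  using sublinear_add[of q x "- x"] sublinear_zero[of q] by simp

text \<open>Homogeneity needs only one inequality: applied to the inverse scalar, it gives the other. Infima
  of sublinear functionals deliver exactly this inequality.\<close>

lemma sublinearI:
  assumes add: "\<And>x y. q (x + y) \<le> q x + q y"
    and zero: "q 0 = 0"
    and le: "\<And>a x. 0 < a \<Longrightarrow> q (a *\<^sub>R x) \<le> a * q x"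
  shows "sublinear q"
proof -
  have "q (a *\<^sub>R x) = a * q x" if "0 \<le> a" for a x
  proof (cases "a = 0")
    case False
    then have a: "0 < a" using that by simp
    have "q ((1 / a) *\<^sub>R (a *\<^sub>R x)) \<le> (1 / a) * q (a *\<^sub>R x)"
      using a by (intro le) simp
    then have "a * q x \<le> q (a *\<^sub>R x)"
      using a by (simp add: field_simps)
    with le[OF a, of x] show ?thesis by simp
  qed (simp add: zero)
  with add show ?thesis by (simp add: sublinear_def)
qed

lemma le_cINF_add:
  fixes f :: "'i \<Rightarrow> real" and g :: "'j \<Rightarrow> real"
  assumes "A \<noteq> {}" "B \<noteq> {}" and le: "\<And>i j. i \<in> A \<Longrightarrow> j \<in> B \<Longrightarrow> z \<le> f i + g j"
  shows "z \<le> (INF i\<in>A. f i) + (INF j\<in>B. g j)"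
proof -
  have "z - (INF j\<in>B. g j) \<le> (INF i\<in>A. f i)"
  proof (rule cINF_greatest[OF assms(1)])
    fix i assume "i \<in> A"
    have "z - f i \<le> (INF j\<in>B. g j)"
      using le[OF \<open>i \<in> A\<close>] by (intro cINF_greatest[OF assms(2)]) (simp add: algebra_simps)
    then show "z - (INF j\<in>B. g j) \<le> f i" by simp
  qed
  then show ?thesis by simp
qed

text \<open>
  This step drives the Hahn-Banach theorem. A sublinear \<open>q\<close> fails to be linear along \<open>v\<close>
  if \<open>q (- v) > - q v\<close>, and then it can be lowered: replace \<open>q x\<close> by the infimum of
  \<open>q (x + t v) - t q v\<close> over \<open>t \<ge> 0\<close>. Sublinearity of \<open>q\<close> bounds these numbers below by \<open>- q (- x)\<close>;
  \<open>t = 0\<close> shows that the result is below \<open>q\<close>, and \<open>t = 1\<close> gives the value at \<open>- v\<close>.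
\<close>

lemma sublinear_decrease_along:
  fixes q :: "'a::real_vector \<Rightarrow> real"
  assumes q: "sublinear q"
  obtains Q where "sublinear Q" "Q \<le> q" "Q (- v) \<le> - q v"
proof
  let ?h = "\<lambda>x t. q (x + t *\<^sub>R v) - t * q v"
  define Q where "Q = (\<lambda>x. INF t\<in>{0..}. ?h x t)"
  have ge: "- q (- x) \<le> ?h x t" if "0 \<le> t" for x t
    using sublinear_add[OF q, of "x + t *\<^sub>R v" "- x"] sublinear_scaleR[OF q that, of v] by simp
  have bdd: "bdd_below (?h x ` {0..})" for x
    using ge by (intro bdd_belowI2[where m = "- q (- x)"]) simp
  have lower: "Q x \<le> ?h x t" if "0 \<le> t" for x t
    unfolding Q_def using that by (intro cINF_lower bdd) simp
  show "Q \<le> q"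
    using lower[of 0] by (simp add: le_fun_def)
  show "Q (- v) \<le> - q v"
    using lower[of 1 "- v"] sublinear_zero[OF q] by simp
  show "sublinear Q"
  proof (rule sublinearI)
    show "Q (x + y) \<le> Q x + Q y" for x y
      unfolding Q_def[THEN fun_cong, of x] Q_def[THEN fun_cong, of y]
    proof (rule le_cINF_add)
      fix s t :: real assume "s \<in> {0..}" "t \<in> {0..}"
      then have "Q (x + y) \<le> q ((x + s *\<^sub>R v) + (y + t *\<^sub>R v)) - (s + t) * q v"
        using lower[of "s + t" "x + y"] by (simp add: algebra_simps)
      also have "\<dots> \<le> ?h x s + ?h y t"
        using sublinear_add[OF q, of "x + s *\<^sub>R v" "y + t *\<^sub>R v"] by (simp add: algebra_simps)
      finally show "Q (x + y) \<le> ?h x s + ?h y t" .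
    qed auto
    show "Q 0 = 0"
      using sublinear_zero[OF q] sublinear_scaleR[OF q] by (simp add: Q_def)
    show "Q (a *\<^sub>R x) \<le> a * Q x" if a: "0 < a" for a x
    proof -
      have "Q (a *\<^sub>R x) / a \<le> Q x"
        unfolding Q_def[THEN fun_cong, of x]
      proof (rule cINF_greatest)
        fix t :: real assume t: "t \<in> {0..}"
        have "Q (a *\<^sub>R x) \<le> q (a *\<^sub>R (x + t *\<^sub>R v)) - (a * t) * q v"
          using lower[of "a * t" "a *\<^sub>R x"] a t by (simp add: algebra_simps)
        also have "\<dots> = a * ?h x t"
          using sublinear_scaleR[OF q, of a "x + t *\<^sub>R v"] a by (simp add: right_diff_distrib)
        finally show "Q (a *\<^sub>R x) / a \<le> ?h x t"
          using a by (simp add: field_simps)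
      qed simp
      then show ?thesis using a by (simp add: field_simps)
    qed
  qed
qed

text \<open>Subadditivity survives the infimum because two members of a chain have a common lower
  bound in the chain: the smaller one.\<close>

lemma sublinear_INF_chain:
  fixes A :: "('a::real_vector \<Rightarrow> real) set"
  assumes "A \<noteq> {}" and sub: "\<And>q. q \<in> A \<Longrightarrow> sublinear q"
    and chain: "\<And>q r. q \<in> A \<Longrightarrow> r \<in> A \<Longrightarrow> q \<le> r \<or> r \<le> q"
    and bdd: "\<And>x. bdd_below ((\<lambda>q. q x) ` A)"
  shows "sublinear (\<lambda>x. INF q\<in>A. q x)"
proof (rule sublinearI)
  let ?m = "\<lambda>x. INF q\<in>A. q x"
  have lower: "?m x \<le> q x" if "q \<in> A" for x q
    using that by (intro cINF_lower bdd)
  show "?m (x + y) \<le> ?m x + ?m y" for x y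
  proof (rule le_cINF_add[OF assms(1,1)])
    fix q r assume qr: "q \<in> A" "r \<in> A"
    have "\<exists>s\<in>A. s \<le> q \<and> s \<le> r"
      using chain[OF qr] qr by blast
    then obtain s where s: "s \<in> A" "s \<le> q" "s \<le> r" by blast
    have "?m (x + y) \<le> s x + s y"
      using lower[OF s(1)] sublinear_add[OF sub[OF s(1)]] by (rule order_trans)
    also have "\<dots> \<le> q x + r y"
      using s by (intro add_mono) (simp_all add: le_fun_def)
    finally show "?m (x + y) \<le> q x + r y" .
  qed
  show "?m 0 = 0"
    using assms(1) sub by (simp add: sublinear_zero)
  show "?m (a *\<^sub>R x) \<le> a * ?m x" if a: "0 < a" for a x
  proof -
    have "?m (a *\<^sub>R x) / a \<le> ?m x"
    proof (rule cINF_greatest[OF assms(1)])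
      fix q assume "q \<in> A"
      then show "?m (a *\<^sub>R x) / a \<le> q x"
        using lower[of q "a *\<^sub>R x"] sublinear_scaleR[OF sub, of q a x] a
        by (simp add: field_simps)
    qed
    then show ?thesis using a by (simp add: field_simps)
  qed
qed

lemma sublinear_odd_imp_linear:
  assumes q: "sublinear q" and odd: "\<And>x. q (- x) = - q x"
  shows "linear q"
proof (rule linearI)
  show "q (x + y) = q x + q y" for x y
    using sublinear_add[OF q, of x y] sublinear_add[OF q, of "- x" "- y"] odd[of "x + y"]
    by (simp add: odd)
  show "q (a *\<^sub>R x) = a *\<^sub>R q x" for a x
  proof (cases "0 \<le> a")
    case False
    then show ?thesis
      using sublinear_scaleR[OF q, of "- a" x] odd[of "a *\<^sub>R x"] by simp
  qed (simp add: sublinear_scaleR[OF q])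
qed

text \<open>
  A minimal sublinear functional below \<open>g\<close> cannot be lowered by \<open>sublinear_decrease_along\<close> in any
  direction, so it is odd and hence linear. Chains have lower bounds because each
  sublinear \<open>q \<le> g\<close> satisfies \<open>q x \<ge> - q (- x) \<ge> - g (- x)\<close>.
\<close>

lemma linear_below_sublinear:
  fixes g :: "'a::real_vector \<Rightarrow> real"
  assumes g: "sublinear g"
  obtains f where "linear f" "f \<le> g"
proof -
  let ?A = "{q. sublinear q \<and> q \<le> g}"
  have "\<exists>m\<in>?A. \<forall>q\<in>?A. m \<ge> q \<longrightarrow> q = m"
  proof (rule predicate_Zorn)
    show "partial_order_on ?A (relation_of (\<ge>) ?A)"
      by (rule partial_order_on_relation_ofI) auto
    fix B assume "B \<in> Chains (relation_of (\<ge>) ?A)"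
    then have B: "B \<subseteq> ?A" and chain: "\<And>q r. q \<in> B \<Longrightarrow> r \<in> B \<Longrightarrow> q \<le> r \<or> r \<le> q"
      by (auto simp: Chains_def relation_of_def)
    show "\<exists>u\<in>?A. \<forall>q\<in>B. q \<ge> u"
    proof (cases "B = {}")
      case True
      then show ?thesis using g by auto
    next
      case False
      have "- g (- x) \<le> q x" if "q \<in> B" for q x
      proof -
        have "sublinear q" "q (- x) \<le> g (- x)"
          using that B by (auto simp: le_fun_def)
        then show ?thesis using sublinear_minus[of q x] by simp
      qed
      then have bdd: "bdd_below ((\<lambda>q. q x) ` B)" for x
        by (rule bdd_belowI2)
      let ?m = "\<lambda>x. INF q\<in>B. q x"
      have below: "?m \<le> q" if "q \<in> B" for q
        using that by (auto simp: le_fun_def intro: cINF_lower bdd)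
      have "sublinear ?m"
        using False B chain bdd by (intro sublinear_INF_chain) auto
      moreover have "?m \<le> g"
        using False B below by (blast intro: order_trans)
      ultimately show ?thesis using below by blast
    qed
  qed
  then obtain f where f: "sublinear f" "f \<le> g"
    and min: "\<And>q. sublinear q \<Longrightarrow> q \<le> g \<Longrightarrow> q \<le> f \<Longrightarrow> q = f" by auto
  have "f (- x) = - f x" for x
  proof -
    obtain Q where Q: "sublinear Q" "Q \<le> f" "Q (- x) \<le> - f x"
      using sublinear_decrease_along[OF f(1)] by blast
    then have "Q = f" using min f(2) by (blast intro: order_trans)
    with Q(3) sublinear_minus[OF f(1), of x] show ?thesis by simp
  qed
  with f show ?thesis by (blast intro: that sublinear_odd_imp_linear)
qed

text \<open>Lowering \<open>g\<close> along \<open>v\<close> before taking a linear minorant \<open>f\<close> forces \<open>f (- v) \<le> - g v\<close>, that is,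
  \<open>f v \<ge> g v\<close>. This replaces the extension of a functional from the line through \<open>v\<close>.\<close>

lemma Hahn_Banach_sublinear:
  fixes g :: "'a::real_vector \<Rightarrow> real"
  assumes g: "sublinear g"
  obtains f where "linear f" "f \<le> g" "f v = g v"
proof -
  obtain Q where Q: "sublinear Q" "Q \<le> g" "Q (- v) \<le> - g v"
    using sublinear_decrease_along[OF g] by blast
  obtain f where f: "linear f" "f \<le> Q"
    using linear_below_sublinear[OF Q(1)] by blast
  have "- f v \<le> - g v"
    using f(2) Q(3) linear_neg[OF f(1), of v] by (metis le_funD order_trans)
  moreover have "f \<le> g" using f(2) Q(2) by simp
  ultimately show ?thesis
    using f(1) by (intro that[of f]) (auto intro: antisym simp: le_fun_def)
qed

section \<open>Separating a point from a convex cone\<close>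

lemma sublinear_infdist_convex_cone:
  fixes K :: "'a::real_normed_vector set"
  assumes K: "convex_cone K"
  shows "sublinear (\<lambda>x. infdist x K)"
proof (rule sublinearI)
  have ne: "K \<noteq> {}" using K by (rule convex_cone_nonempty)
  show "infdist (x + y) K \<le> infdist x K + infdist y K" for x y
    unfolding infdist_notempty[OF ne, of x] infdist_notempty[OF ne, of y]
  proof (rule le_cINF_add[OF ne ne])
    fix k l assume "k \<in> K" "l \<in> K"
    then have "infdist (x + y) K \<le> dist (x + y) (k + l)"
      by (intro infdist_le convex_cone_add[OF K])
    also have "\<dots> \<le> dist x k + dist y l"
      by (rule dist_triangle_add)
    finally show "infdist (x + y) K \<le> dist x k + dist y l" .
  qed
  show "infdist 0 K = 0"
    using convex_cone_contains_0[OF K] by simp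
  show "infdist (a *\<^sub>R x) K \<le> a * infdist x K" if a: "0 < a" for a x
  proof -
    have "infdist (a *\<^sub>R x) K / a \<le> infdist x K"
      unfolding infdist_notempty[OF ne, of x]
    proof (rule cINF_greatest[OF ne])
      fix k assume "k \<in> K"
      then have "infdist (a *\<^sub>R x) K \<le> dist (a *\<^sub>R x) (a *\<^sub>R k)"
        using a by (intro infdist_le convex_cone_scaleR[OF K]) simp_all
      also have "\<dots> = a * dist x k"
        using a by (simp add: dist_norm flip: scaleR_diff_right)
      finally show "infdist (a *\<^sub>R x) K / a \<le> dist x k"
        using a by (simp add: field_simps)
    qed
    then show ?thesis using a by (simp add: field_simps)
  qed
qed

text \<open>
  Let \<open>f\<close> be a linear functional below the distance to \<open>K\<close> and equal to it at \<open>v\<close>. It is bounded since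
  \<open>0 \<in> K\<close> makes the distance at most the norm, it is nonpositive on \<open>K\<close> where the distance vanishes,
  and it is positive at \<open>v\<close>. The separating functional is \<open>- f\<close>.
\<close>

lemma separate_point_convex_cone:
  fixes K :: "'a::real_normed_vector set"
  assumes K: "convex_cone K" and v: "v \<notin> closure K"
  obtains \<theta> :: "'a \<Rightarrow>\<^sub>L real"
  where "\<And>k. k \<in> K \<Longrightarrow> 0 \<le> blinfun_apply \<theta> k" "blinfun_apply \<theta> v < 0"
proof -
  obtain f where f: "linear f" "f \<le> (\<lambda>x. infdist x K)" "f v = infdist v K"
    using Hahn_Banach_sublinear[OF sublinear_infdist_convex_cone[OF K]] by blast
  have le: "f x \<le> infdist x K" for x
    using f(2) by (simp add: le_fun_def)
  have "infdist x K \<le> norm x" for x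
    using infdist_le[OF convex_cone_contains_0[OF K], of x] by simp
  then have "f x \<le> norm x" for x
    using le order_trans by blast
  from this[of "- x" for x] this have "norm (f x) \<le> norm x * 1" for x
    by (simp add: abs_le_iff linear_neg[OF f(1)])
  then have "bounded_linear f"
    using linear_add[OF f(1)] linear_scale[OF f(1)]
    by (intro bounded_linear_intro[where K = 1]) auto
  then have "bounded_linear (\<lambda>x. - f x)"
    by (rule bounded_linear_minus)
  then have \<theta>: "blinfun_apply (Blinfun (\<lambda>x. - f x)) x = - f x" for x
    by (simp add: bounded_linear_Blinfun_apply)
  have "f k \<le> 0" if "k \<in> K" for k
    using le[of k] that by simp
  moreover have "0 < f v"
    using v K f(3) infdist_nonneg[of v K]
    by (metis convex_cone_nonempty in_closure_iff_infdist_zero less_eq_real_def)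
  ultimately show ?thesis
    by (intro that[of "Blinfun (\<lambda>x. - f x)"]) (simp_all add: \<theta>)
qed

section \<open>Continuous almost nearest points in a convex set\<close>

text \<open>
  For each \<open>q \<in> C\<close>, the points \<open>x\<close> for which \<open>q\<close> is a good enough approximation of \<open>f x\<close> form an open
  set, and these sets cover \<open>S\<close>. With a partition of unity subordinate to a locally finite refinement,
  \<open>c x\<close> is an average of points that are all good enough for \<open>x\<close>; it inherits membership in \<open>C\<close> and
  closeness to \<open>f x\<close>, since \<open>C\<close> and balls are convex.
\<close>

lemma continuous_almost_nearest_point:
  fixes f :: "'a::{metric_space,second_countable_topology} \<Rightarrow> 'b::real_normed_vector"
  assumes S: "open S" and C: "convex C" "C \<noteq> {}"
    and f: "continuous_on S f" and r: "continuous_on S r"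
    and near: "\<And>x. x \<in> S \<Longrightarrow> infdist (f x) C < r x"
  obtains c where "continuous_on S c" "c ` S \<subseteq> C" "\<And>x. x \<in> S \<Longrightarrow> dist (f x) (c x) < r x"
proof -
  define U where "U q = {x \<in> S. dist (f x) q < r x}" for q
  have openU: "open (U q)" for q
  proof -
    have "open (S \<inter> (\<lambda>x. r x - dist (f x) q) -` {0<..})"
      using f r by (intro continuous_open_preimage continuous_intros S) auto
    also have "S \<inter> (\<lambda>x. r x - dist (f x) q) -` {0<..} = U q"
      by (auto simp: U_def)
    finally show ?thesis .
  qed
  have cover: "S \<subseteq> \<Union>(U ` C)"
  proof
    fix x assume x: "x \<in> S"
    then have "\<exists>q\<in>C. dist (f x) q < r x"
      using near[OF x] C by (simp add: infdist_notempty cINF_less_iff)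
    with x show "x \<in> \<Union>(U ` C)" by (auto simp: U_def)
  qed
  obtain \<C> where \<C>: "S \<subseteq> \<Union>\<C>" "\<And>T. T \<in> \<C> \<Longrightarrow> open T \<and> (\<exists>W. W \<in> U ` C \<and> T \<subseteq> W)"
    "\<And>x. x \<in> S \<Longrightarrow> \<exists>V. open V \<and> x \<in> V \<and> finite {T. T \<in> \<C> \<and> T \<inter> V \<noteq> {}}"
    by (rule paracompact[OF cover]) (use openU in auto)
  have "\<exists>q\<in>C. T \<subseteq> U q" if "T \<in> \<C>" for T
    using \<C>(2)[OF that] by auto
  then obtain a where a: "\<And>T. T \<in> \<C> \<Longrightarrow> a T \<in> C \<and> T \<subseteq> U (a T)"
    by metis
  obtain H :: "['a set, 'a] \<Rightarrow> real"
    where H: "\<And>T. T \<in> \<C> \<Longrightarrow> continuous_on S (H T) \<and> (\<forall>x\<in>S. 0 \<le> H T x)"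
      and H0: "\<And>x T. \<lbrakk>T \<in> \<C>; x \<in> S; x \<notin> T\<rbrakk> \<Longrightarrow> H T x = 0"
      and H1: "\<And>x. x \<in> S \<Longrightarrow> supp_sum (\<lambda>T. H T x) \<C> = 1"
      and Hfin: "\<And>x. x \<in> S \<Longrightarrow> \<exists>V. open V \<and> x \<in> V \<and> finite {T \<in> \<C>. \<exists>x\<in>V. H T x \<noteq> 0}"
    by (rule subordinate_partition_of_unity[OF \<C>(1) _ \<C>(3)]) (use \<C>(2) in auto)
  define c where "c x = supp_sum (\<lambda>T. H T x *\<^sub>R a T) \<C>" for x
  have mem: "c x \<in> C \<inter> ball (f x) (r x)" if x: "x \<in> S" for x
    unfolding c_def
  proof (rule convex_supp_sum)
    show "convex (C \<inter> ball (f x) (r x))"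
      using C by (intro convex_Int convex_ball)
    show "supp_sum (\<lambda>T. H T x) \<C> = 1" using H1[OF x] .
    show "0 \<le> H T x \<and> (H T x = 0 \<or> a T \<in> C \<inter> ball (f x) (r x))" if "T \<in> \<C>" for T
    proof (cases "x \<in> T")
      case True
      then have "a T \<in> C \<inter> ball (f x) (r x)"
        using a[OF that] by (auto simp: U_def)
      then show ?thesis using H that x by auto
    next
      case False
      then show ?thesis using H0[OF that x] by simp
    qed
  qed
  have "continuous_on S c"
  proof (rule continuous_at_imp_continuous_on, rule ballI)
    fix x assume x: "x \<in> S"
    obtain V where V: "open V" "x \<in> V" and fin: "finite {T \<in> \<C>. \<exists>x\<in>V. H T x \<noteq> 0}"
      using Hfin[OF x] by auto
    let ?F = "{T \<in> \<C>. \<exists>x\<in>V. H T x \<noteq> 0}"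
    have "continuous_on (S \<inter> V) (\<lambda>y. \<Sum>T\<in>?F. H T y *\<^sub>R a T)"
      using H by (intro continuous_intros) (auto intro: continuous_on_subset)
    moreover have "(\<Sum>T\<in>?F. H T y *\<^sub>R a T) = c y" if "y \<in> S \<inter> V" for y
      unfolding c_def supp_sum_def
      by (rule sum.mono_neutral_right[OF fin]) (use that in \<open>auto simp: support_on_def\<close>)
    ultimately have "continuous_on (S \<inter> V) c"
      by (rule continuous_on_eq)
    then show "isCont c x"
      using S V x by (simp add: continuous_on_eq_continuous_at open_Int)
  qed
  with mem show ?thesis by (intro that[of c]) auto
qed

section \<open>Curves with prescribed one-sided velocity\<close>

text \<open>
  Let \<open>s (q - p)\<close> be an element of the cone within \<open>e\<close> of \<open>v\<close>. As long as \<open>t s \<le> 1\<close>, the point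
  \<open>p + t s (q - p)\<close> is on the segment from \<open>p\<close> to \<open>q\<close>, hence in \<open>C\<close>, and its distance to \<open>p + t v\<close>
  is less than \<open>e t\<close> for \<open>t > 0\<close>.
\<close>

lemma infdist_ray_le:
  fixes C :: "'a::real_normed_vector set"
  assumes C: "convex C" "p \<in> C"
    and v: "v \<in> closure (cone hull ((\<lambda>q. q - p) ` C))" and e: "0 < e"
  shows "\<exists>d>0. \<forall>t. 0 \<le> t \<and> t \<le> d \<longrightarrow> infdist (p + t *\<^sub>R v) C \<le> e * t"
proof -
  obtain k where k: "k \<in> cone hull ((\<lambda>q. q - p) ` C)" "dist k v < e"
    using v e closure_approachable by blast
  then obtain s q where s: "0 \<le> s" and q: "q \<in> C" and ks: "k = s *\<^sub>R (q - p)"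
    unfolding cone_hull_expl by auto
  have "infdist (p + t *\<^sub>R v) C \<le> e * t" if t: "0 \<le> t" "t \<le> 1 / (s + 1)" for t
  proof -
    have "t * s \<le> t * (s + 1)" using t s by (intro mult_left_mono) auto
    also have "\<dots> \<le> 1" using t s by (simp add: field_simps)
    finally have ts: "t * s \<le> 1" .
    have "p + t *\<^sub>R k = (1 - t * s) *\<^sub>R p + (t * s) *\<^sub>R q"
      by (simp add: ks algebra_simps)
    also have "\<dots> \<in> C"
      using C q t s ts by (intro convexD) auto
    finally have "infdist (p + t *\<^sub>R v) C \<le> dist (p + t *\<^sub>R v) (p + t *\<^sub>R k)"
      by (rule infdist_le)
    also have "\<dots> = t * dist k v"
      using t by (simp add: dist_norm norm_minus_commute flip: scaleR_diff_right)
    also have "\<dots> \<le> e * t"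
      using mult_left_mono[of "dist k v" e t] k(2) t by (simp add: mult.commute)
    finally show ?thesis .
  qed
  \<comment> \<open>The bound \<open>1 / (s + 1)\<close> instead of \<open>1 / s\<close> covers \<open>s = 0\<close>.\<close>
  then show ?thesis using s by (intro exI[of _ "1 / (s + 1)"]) auto
qed

text \<open>The curve follows the ray \<open>p + t v\<close> with error less than \<open>r t\<close> for \<open>t > 0\<close>, the distance of the ray
  to \<open>C\<close> plus \<open>t\<^sup>2\<close>. The added term makes the bound strictly larger than the distance, and \<open>r t / t\<close>
  still tends to \<open>0\<close>. Continuity of the curve at \<open>0\<close> holds because \<open>r\<close> is continuous and
  vanishes there.\<close>

lemma exists_curve_with_velocity:
  fixes C :: "'a::real_normed_vector set"
  assumes C: "convex C" "p \<in> C"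
    and v: "v \<in> closure (cone hull ((\<lambda>q. q - p) ` C))"
  shows "\<exists>c :: real \<Rightarrow> 'a.
            continuous_on {0..} c \<and> (\<forall>t\<ge>0. c t \<in> C) \<and> c 0 = p \<and>
            ((\<lambda>t. (c t - c 0) /\<^sub>R t) \<longlongrightarrow> v) (at_right 0)"
proof -
  define r where "r t = infdist (p + t *\<^sub>R v) C + t\<^sup>2" for t
  have r: "continuous_on A r" for A
    unfolding r_def by (intro continuous_intros)
  obtain b where b: "continuous_on {0<..} b" "b ` {0<..} \<subseteq> C"
    and near: "\<And>t. t \<in> {0<..} \<Longrightarrow> dist (p + t *\<^sub>R v) (b t) < r t"
    by (rule continuous_almost_nearest_point[of "{0<..}" C "\<lambda>t. p + t *\<^sub>R v" r])
      (use C in \<open>auto intro!: continuous_intros r simp: r_def\<close>)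
  define c where "c t = (if t = 0 then p else b t)" for t
  have c0: "c 0 = p" and cb: "\<And>t. 0 < t \<Longrightarrow> c t = b t"
    by (auto simp: c_def)
  have near': "dist (p + t *\<^sub>R v) (c t) \<le> r t" if "0 \<le> t" for t
    using near[of t] that C by (cases "t = 0") (auto simp: c_def r_def)
  have cont0: "(c \<longlongrightarrow> p) (at 0 within {0..})"
  proof -
    have "((\<lambda>t. r t) \<longlongrightarrow> r 0) (at 0 within {0..})"
      using r[of "{0..}"] by (simp add: continuous_on_def)
    then have "(r \<longlongrightarrow> 0) (at 0 within {0..})"
      using C by (simp add: r_def[of 0])
    then have "((\<lambda>t. c t - (p + t *\<^sub>R v)) \<longlongrightarrow> 0) (at 0 within {0..})"
      by (rule Lim_null_comparison[rotated])
        (use near' in \<open>auto simp: eventually_at_filter dist_norm norm_minus_commute\<close>)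
    moreover have "((\<lambda>t. p + t *\<^sub>R v) \<longlongrightarrow> p + 0 *\<^sub>R v) (at 0 within {0..})"
      by (intro tendsto_intros)
    ultimately have "((\<lambda>t. (c t - (p + t *\<^sub>R v)) + (p + t *\<^sub>R v)) \<longlongrightarrow> 0 + (p + 0 *\<^sub>R v))
        (at 0 within {0..})"
      by (rule tendsto_add)
    then show ?thesis by simp
  qed
  have "continuous_on {0..} c"
  proof -
    have "continuous_on {0<..} c"
      using b(1) cb by (auto intro: continuous_on_eq)
    then have "isCont c t" if "0 < t" for t
      using that by (simp add: continuous_on_eq_continuous_at)
    then have "(c \<longlongrightarrow> c t) (at t within {0..})" if "0 \<le> t" for t
    proof (cases "t = 0")
      case False
      with that have "isCont c t" by (intro \<open>\<And>t. 0 < t \<Longrightarrow> isCont c t\<close>) simp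
      then show ?thesis
        unfolding isCont_def by (rule Lim_at_imp_Lim_at_within)
    qed (use cont0 c0 in simp)
    then show ?thesis by (simp add: continuous_on_def)
  qed
  moreover have "\<forall>t\<ge>0. c t \<in> C"
    using b(2) C by (auto simp: c_def)
  moreover have "((\<lambda>t. (c t - c 0) /\<^sub>R t) \<longlongrightarrow> v) (at_right 0)"
  proof (rule tendstoI)
    fix e :: real assume e: "0 < e"
    obtain d where d: "0 < d" "\<And>t. 0 \<le> t \<Longrightarrow> t \<le> d \<Longrightarrow> infdist (p + t *\<^sub>R v) C \<le> (e / 2) * t"
      using infdist_ray_le[OF C v, of "e / 2"] e by auto
    have "dist ((c t - c 0) /\<^sub>R t) v < e" if t: "0 < t" "t < d" "t < e / 2" for t
    proof -
      have "(c t - c 0) /\<^sub>R t - v = (c t - (p + t *\<^sub>R v)) /\<^sub>R t"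
        using t(1) by (simp add: c0 scaleR_diff_right scaleR_add_right)
      then have "dist ((c t - c 0) /\<^sub>R t) v = dist (p + t *\<^sub>R v) (c t) / t"
        using t(1) unfolding dist_norm norm_minus_commute[of "p + t *\<^sub>R v"]
        by (simp add: divide_inverse)
      also have "\<dots> \<le> r t / t"
        using t(1) by (intro divide_right_mono near') simp_all
      also have "\<dots> \<le> ((e / 2) * t + t\<^sup>2) / t"
        using t unfolding r_def by (intro divide_right_mono add_right_mono d(2)) simp_all
      also have "\<dots> = e / 2 + t"
        using t(1) by (simp add: field_simps power2_eq_square)
      also have "\<dots> < e" using t(3) by simp
      finally show ?thesis .
    qed
    then show "\<forall>\<^sub>F t in at_right 0. dist ((c t - c 0) /\<^sub>R t) v < e"
      using d(1) e unfolding eventually_at_right_field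
      by (intro exI[of _ "min d (e / 2)"]) auto
  qed
  ultimately show ?thesis using c0 by blast
qed

lemma velocity_nonneg_on_support:
  fixes \<theta> :: "'a::real_normed_vector \<Rightarrow>\<^sub>L real"
  assumes c: "\<And>t. 0 \<le> t \<Longrightarrow> c t \<in> C"
    and lim: "((\<lambda>t. (c t - c 0) /\<^sub>R t) \<longlongrightarrow> v) (at_right (0::real))"
    and min: "\<And>q. q \<in> C \<Longrightarrow> blinfun_apply \<theta> (c 0) \<le> blinfun_apply \<theta> q"
  shows "0 \<le> blinfun_apply \<theta> v"
proof (rule tendsto_lowerbound)
  show "((\<lambda>t. blinfun_apply \<theta> ((c t - c 0) /\<^sub>R t)) \<longlongrightarrow> blinfun_apply \<theta> v) (at_right 0)"
    by (intro blinfun.tendsto tendsto_const lim)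
  have "0 \<le> blinfun_apply \<theta> ((c t - c 0) /\<^sub>R t)" if "0 < t" for t
    using min[OF c[of t]] that by (simp add: blinfun.scaleR_right blinfun.diff_right)
  then show "\<forall>\<^sub>F t in at_right 0. 0 \<le> blinfun_apply \<theta> ((c t - c 0) /\<^sub>R t)"
    by (auto simp: eventually_at_filter)
qed simp

lemma eq_INF_ereal_iff:
  assumes "p \<in> C"
  shows "ereal (f p) = (INF q\<in>C. ereal (f q)) \<longleftrightarrow> (\<forall>q\<in>C. f p \<le> f q)"
proof
  assume "ereal (f p) = (INF q\<in>C. ereal (f q))"
  then show "\<forall>q\<in>C. f p \<le> f q"
    by (metis INF_lower ereal_less_eq(3))
next
  assume "\<forall>q\<in>C. f p \<le> f q"
  then show "ereal (f p) = (INF q\<in>C. ereal (f q))"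
    using assms by (intro antisym INF_greatest INF_lower) auto
qed

theorem corollary2:
  fixes C :: "'a::real_normed_vector set" and p v :: 'a
  assumes "closed C" and "convex C" and "p \<in> C"
  shows "(\<exists>c :: real \<Rightarrow> 'a.
            continuous_on {0..} c \<and> (\<forall>t\<ge>0. c t \<in> C) \<and> c 0 = p \<and>
            ((\<lambda>t. (c t - c 0) /\<^sub>R t) \<longlongrightarrow> v) (at_right 0))
         \<longleftrightarrow>
         (\<forall>\<theta> :: 'a \<Rightarrow>\<^sub>L real.
            ereal (blinfun_apply \<theta> p) = (INF q\<in>C. ereal (blinfun_apply \<theta> q)) \<longrightarrow>
            blinfun_apply \<theta> v \<ge> 0)"
  (is "?curve \<longleftrightarrow> ?dual")
proof
  assume ?curve
  then obtain c :: "real \<Rightarrow> 'a" where c: "\<And>t. 0 \<le> t \<Longrightarrow> c t \<in> C" "c 0 = p"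
    "((\<lambda>t. (c t - c 0) /\<^sub>R t) \<longlongrightarrow> v) (at_right 0)" by blast
  show ?dual
  proof (intro allI impI)
    fix \<theta> :: "'a \<Rightarrow>\<^sub>L real"
    assume "ereal (blinfun_apply \<theta> p) = (INF q\<in>C. ereal (blinfun_apply \<theta> q))"
    then have "\<forall>q\<in>C. blinfun_apply \<theta> p \<le> blinfun_apply \<theta> q"
      by (rule eq_INF_ereal_iff[OF \<open>p \<in> C\<close>, THEN iffD1])
    then show "0 \<le> blinfun_apply \<theta> v"
      by (intro velocity_nonneg_on_support[OF c(1) c(3)]) (simp_all add: c(2))
  qed
next
  assume dual: ?dual
  let ?K = "cone hull ((\<lambda>q. q - p) ` C)"
  have K: "convex_cone ?K"
    unfolding convex_cone_def
  proof (intro conjI)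
    have "p - p \<in> ?K" using \<open>p \<in> C\<close> by (intro hull_inc imageI)
    then show "?K \<noteq> {}" by blast
    show "convex ?K"
      by (rule convex_cone_hull[OF convex_translation_subtract[OF \<open>convex C\<close>]])
    show "conic ?K"
      unfolding conic_def by (blast intro: mem_cone[OF cone_cone_hull])
  qed
  have "v \<in> closure ?K"
  proof (rule ccontr)
    assume "v \<notin> closure ?K"
    then obtain \<theta> :: "'a \<Rightarrow>\<^sub>L real"
      where pos: "\<And>k. k \<in> ?K \<Longrightarrow> 0 \<le> blinfun_apply \<theta> k" and neg: "blinfun_apply \<theta> v < 0"
      using separate_point_convex_cone[OF K] by blast
    have "\<forall>q\<in>C. blinfun_apply \<theta> p \<le> blinfun_apply \<theta> q"
    proof
      fix q assume "q \<in> C"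
      then have "q - p \<in> ?K" by (intro hull_inc imageI)
      from pos[OF this] show "blinfun_apply \<theta> p \<le> blinfun_apply \<theta> q"
        by (simp add: blinfun.diff_right)
    qed
    then have "ereal (blinfun_apply \<theta> p) = (INF q\<in>C. ereal (blinfun_apply \<theta> q))"
      by (rule eq_INF_ereal_iff[OF \<open>p \<in> C\<close>, THEN iffD2])
    then have "0 \<le> blinfun_apply \<theta> v"
      using dual by simp
    with neg show False by simp
  qed
  then show ?curve
    using \<open>convex C\<close> \<open>p \<in> C\<close> by (intro exists_curve_with_velocity)
qed

end
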